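(* For every integer $n\ge 1$, $F_n(X,Y)=U_n(X,-Y)$ in $\mathbb{Z}[X,Y]$, where $U_n(X,Y)$ is the $n$th generalized Fibonacci polynomial and $F_n(X,Y)$ is the integer polynomial expressing the complete symmetric polynomial of degree $n-1$ in two indeterminates in terms of the elementary symmetric polynomials.
   Context: Let $a,b$ be indeterminates, let $e_1=a+b$ and $e_2=ab$ be the elementary symmetric polynomials, and for $m\ge 0$ let $h_m=\sum_{k=0}^{m}a^{m-k}b^{k}$ be the complete symmetric polynomial of degree $m$. For each integer $n\ge 1$, $F_n(X,Y)\in\mathbb{Z}[X,Y]$ denotes the unique polynomial with integer coefficients such that $F_n(e_1,e_2)=h_{n-1}$ holds as an identity in $\mathbb{Z}[a,b]$. (Existence and uniqueness are given by the fundamental theorem on symmetric polynomials in two indeterminates.) The generalized Fibonacci polynomials $U_n(X,Y)\in\mathbb{Z}[X,Y]$ are defined by $U_0=0$, $U_1=1$, and $U_n=X\,U_{n-1}+Y\,U_{n-2}$ for $n\ge 2$. *)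

theory Defs
  imports "HOL-Computational_Algebra.Polynomial"
begin

(* The ring of integer polynomials in two indeterminates is int poly poly: the first
   indeterminate is that of the coefficient ring int poly, the second one the outer one.
   The same type serves as Z[a,b] and as Z[X,Y]. *)

type_synonym bipoly = "int poly poly"

definition indet1 :: bipoly where "indet1 = [:[:0, 1:]:]"

definition indet2 :: bipoly where "indet2 = [:0, 1:]"

(* The value P(u,v) in an arbitrary commutative ring. *)

definition eval2 :: "bipoly \<Rightarrow> 'a::comm_ring_1 \<Rightarrow> 'a \<Rightarrow> 'a" where
  "eval2 P u v = poly (map_poly (\<lambda>p. poly (map_poly of_int p) u) P) v"

lemma eval2_indet1: "eval2 indet1 u v = u"
  by (simp add: eval2_def indet1_def map_poly_pCons)

lemma eval2_indet2: "eval2 indet2 u v = v"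
  by (simp add: eval2_def indet2_def map_poly_pCons)

lemma poly_map_poly_eq_sum:
  fixes x :: "'a::comm_ring_1"
  assumes "f 0 = 0"
  shows "poly (map_poly f p) x = (\<Sum>i\<le>degree p. f (coeff p i) * x ^ i)"
proof -
  have "poly (map_poly f p) x = (\<Sum>i\<le>degree (map_poly f p). f (coeff p i) * x ^ i)"
    by (simp add: poly_altdef coeff_map_poly assms)
  also have "\<dots> = (\<Sum>i\<le>degree p. f (coeff p i) * x ^ i)"
  proof (rule sum.mono_neutral_left)
    have "degree (map_poly f p) \<le> degree p"
      by (rule degree_le) (simp add: coeff_map_poly coeff_eq_0 assms)
    then show "{..degree (map_poly f p)} \<subseteq> {..degree p}"
      by simp
    have "f (coeff p i) = 0" if "degree (map_poly f p) < i" for i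
      using coeff_eq_0[OF that] by (simp add: coeff_map_poly assms)
    then show "\<forall>i\<in>{..degree p} - {..degree (map_poly f p)}. f (coeff p i) * x ^ i = 0"
      by simp
  qed simp
  finally show ?thesis .
qed

lemma eval2_eq_sum:
  "eval2 P u v =
    (\<Sum>j\<le>degree P. \<Sum>i\<le>degree (coeff P j). of_int (coeff (coeff P j) i) * u ^ i * v ^ j)"
  by (simp add: eval2_def poly_map_poly_eq_sum sum_distrib_right)

(* Symmetric polynomials in the indeterminates a = indet1 and b = indet2. *)

definition e1 :: bipoly where "e1 = indet1 + indet2"

definition e2 :: bipoly where "e2 = indet1 * indet2"

definition h :: "nat \<Rightarrow> bipoly" where
  "h m = (\<Sum>k=0..m. indet1 ^ (m - k) * indet2 ^ k)"

definition F :: "nat \<Rightarrow> bipoly" where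
  "F n = (THE P. eval2 P e1 e2 = h (n - 1))"

(* Here X = indet1 and Y = indet2. *)

fun U :: "nat \<Rightarrow> bipoly" where
  "U 0 = 0"
| "U (Suc 0) = 1"
| "U (Suc (Suc n)) = indet1 * U (Suc n) + indet2 * U n"

end

theory Submission
  imports Defs
begin

text \<open>
  Let \<open>V n\<close> denote \<open>U n\<close> evaluated at \<open>X, -Y\<close>. Because evaluation is a ring homomorphism,
  \<open>V (n + 2) = X * V (n + 1) - Y * V n\<close>. Writing \<open>a\<close>, \<open>b\<close> for the two indeterminates, the
  complete symmetric polynomials obey the same recurrence with \<open>X\<close>, \<open>Y\<close> replaced by
  \<open>e1 = a + b\<close>, \<open>e2 = a * b\<close> (lemma \<open>h_Suc_Suc\<close>), which reflects that \<open>a\<close> and \<open>b\<close> are the roots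
  of \<open>T^2 - e1 * T + e2\<close>. The initial values agree, so \<open>V n\<close> evaluated at \<open>e1, e2\<close> is
  \<open>h (n - 1)\<close> for \<open>n \<ge> 1\<close> (lemma \<open>eval2_U_e1_e2\<close>).

  As \<open>F n\<close> is a definite description, it remains to see that this property determines \<open>V n\<close>, that is,
  that \<open>e1\<close> and \<open>e2\<close> are algebraically independent (lemma \<open>e1_e2_algebraically_independent\<close>).
  Setting \<open>b = 0\<close> sends \<open>e1\<close> to \<open>a\<close> and \<open>e2\<close> to \<open>0\<close>, so a relation \<open>P(e1, e2) = 0\<close> forces the
  part of \<open>P\<close> free of \<open>Y\<close> to vanish; then \<open>P = Y * Q\<close>, and \<open>Q\<close> is a relation of smaller
  degree in \<open>Y\<close>, because \<open>e2\<close> can be cancelled in an integral domain.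
\<close>

lemma poly_map_poly_add:
  fixes f :: "'a::comm_ring_1 \<Rightarrow> 'b::comm_ring_1"
  assumes add: "\<And>a b. f (a + b) = f a + f b"
  shows "poly (map_poly f (p + q)) x = poly (map_poly f p) x + poly (map_poly f q) x"
proof -
  have "f 0 = 0"
    using add[of 0 0] by simp
  then have "map_poly f (p + q) = map_poly f p + map_poly f q"
    by (intro poly_eqI) (simp add: coeff_map_poly add)
  then show ?thesis by simp
qed

lemma poly_map_poly_mult:
  fixes f :: "'a::comm_ring_1 \<Rightarrow> 'b::comm_ring_1"
  assumes add: "\<And>a b. f (a + b) = f a + f b"
    and mult: "\<And>a b. f (a * b) = f a * f b"
  shows "poly (map_poly f (p * q)) x = poly (map_poly f p) x * poly (map_poly f q) x"
proof (induction p)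
  case 0
  show ?case by simp
next
  case (pCons a p)
  have f0: "f 0 = 0"
    using add[of 0 0] by simp
  have smult: "map_poly f (smult a q) = smult (f a) (map_poly f q)"
    by (intro poly_eqI) (simp add: coeff_map_poly f0 mult)
  show ?case
    by (simp add: poly_map_poly_add[of f, OF add] smult map_poly_pCons f0 pCons.IH algebra_simps)
qed

lemma eval2_0: "eval2 0 u v = 0"
  by (simp add: eval2_def)

lemma eval2_1: "eval2 1 u v = 1"
  by (simp add: eval2_def)

lemma eval2_add: "eval2 (P + Q) u v = eval2 P u v + eval2 Q u v"
  unfolding eval2_def by (intro poly_map_poly_add) simp

lemma eval2_mult: "eval2 (P * Q) u v = eval2 P u v * eval2 Q u v"
  unfolding eval2_def by (intro poly_map_poly_mult poly_map_poly_add) simp_all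

lemma eval2_minus: "eval2 (- P) u v = - eval2 P u v"
  using eval2_add[of P "- P" u v] by (simp add: eval2_0 minus_unique)

lemma eval2_diff: "eval2 (P - Q) u v = eval2 P u v - eval2 Q u v"
  using eval2_add[of P "- Q" u v] by (simp add: eval2_minus)

lemma eval2_pCons: "eval2 (pCons p Q) u v = poly (map_poly of_int p) u + v * eval2 Q u v"
  by (simp add: eval2_def map_poly_pCons)

text \<open>Specialising the second indeterminate to \<open>0\<close> turns \<open>e1\<close> into the first one, so no
  information about \<open>p\<close> is lost.\<close>

lemma poly_of_int_e1_at_0: "poly (poly (map_poly of_int p) e1) 0 = p"
  by (induction p)
    (simp_all add: map_poly_pCons e1_def indet1_def indet2_def of_int_poly)

lemma e1_e2_algebraically_independent:
  assumes "eval2 P e1 e2 = 0"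
  shows "P = 0"
  using assms
proof (induction P)
  case 0
  show ?case by simp
next
  case (pCons p Q)
  have relation: "poly (map_poly of_int p) e1 + e2 * eval2 Q e1 e2 = 0"
    using pCons.prems by (simp add: eval2_pCons)
  have "poly e2 0 = 0"
    by (simp add: e2_def indet1_def indet2_def)
  then have "p = 0"
    using arg_cong[OF relation, of "\<lambda>R. poly R 0"] by (simp add: poly_of_int_e1_at_0)
  moreover have "e2 \<noteq> 0"
    by (simp add: e2_def indet1_def indet2_def)
  ultimately have "eval2 Q e1 e2 = 0"
    using relation by simp
  then show ?case
    using \<open>p = 0\<close> pCons.IH by simp
qed

lemma h_Suc: "h (Suc m) = indet1 * h m + indet2 ^ Suc m"
  by (simp add: h_def sum_distrib_left Suc_diff_le mult.assoc)

text \<open>Eliminating the power of the second indeterminate between two consecutive instances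
  of \<open>h_Suc\<close> leaves coefficients that are symmetric.\<close>

lemma h_Suc_Suc: "h (Suc (Suc m)) = e1 * h (Suc m) - e2 * h m"
  by (simp add: h_Suc e1_def e2_def algebra_simps)

lemma eval2_U_e1_e2: "eval2 (eval2 (U (Suc n)) indet1 (- indet2)) e1 e2 = h n"
proof (induction n rule: U.induct)
  case 1
  show ?case by (simp add: eval2_1 h_def)
next
  case 2
  show ?case
    by (simp add: eval2_0 eval2_1 eval2_add eval2_mult eval2_indet1 eval2_indet2 h_def e1_def)
next
  case (3 n)
  have "eval2 (U (Suc (Suc (Suc n)))) indet1 (- indet2) =
      indet1 * eval2 (U (Suc (Suc n))) indet1 (- indet2)
      - indet2 * eval2 (U (Suc n)) indet1 (- indet2)"
    unfolding U.simps(3)[of "Suc n"]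
    by (simp only: eval2_add eval2_mult eval2_indet1 eval2_indet2 mult_minus_left add_uminus_conv_diff)
  then show ?case
    by (simp only: eval2_diff eval2_mult eval2_indet1 eval2_indet2 3 h_Suc_Suc)
qed

theorem mainTheorem3:
  fixes n :: nat
  assumes "n \<ge> 1"
  shows "F n = eval2 (U n) indet1 (- indet2)"
proof -
  have V: "eval2 (eval2 (U n) indet1 (- indet2)) e1 e2 = h (n - 1)"
    using eval2_U_e1_e2[of "n - 1"] assms by simp
  show ?thesis
    unfolding F_def
  proof (rule the_equality)
    fix P
    assume "eval2 P e1 e2 = h (n - 1)"
    then have "eval2 (P - eval2 (U n) indet1 (- indet2)) e1 e2 = 0"
      by (simp add: eval2_diff V)
    then show "P = eval2 (U n) indet1 (- indet2)"
      using e1_e2_algebraically_independent by fastforce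
  qed (fact V)
qed

end
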